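(* Let $G$ be a trigraph and let $G'$ be the trigraph obtained from $G$ by adding one new vertex $v$ and joining it by black edges to all vertices of an arbitrary subset $X\subseteq V(G)$ (and to no other vertex). Then $\mathrm{tww}(G')\le 2(\mathrm{tww}(G)+1)$.
   Context: A trigraph is a triple $G=(V,E,R)$ where $E$ and $R$ are disjoint sets of unordered pairs of distinct vertices, the black edges and red edges. For distinct $u,v\in V$, the contraction $G/u,v$ replaces $u,v$ by a new vertex $w$, with $G-\{u,v\}=(G/u,v)-\{w\}$, and for every other vertex $x$: $wx$ is black iff $ux$ and $vx$ are both black; $wx$ is neither black nor red iff neither $ux$ nor $vx$ is black or red; $wx$ is red otherwise. A $d$-trigraph is a trigraph whose red edges form a graph of maximum degree at most $d$. The twin-width $\mathrm{tww}(G)$ of an $n$-vertex trigraph $G$ is the least $d$ such that there is a sequence $G=G_n,G_{n-1},\ldots,G_1$ of $d$-trigraphs with $G_{i-1}$ a contraction of $G_i$ for each $i$ and $G_1$ a single vertex. *)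

theory Defs
  imports Main
begin

record 'a trigraph =
  verts :: "'a set"
  black :: "'a set set"
  red :: "'a set set"

definition wf_trigraph :: "'a trigraph \<Rightarrow> bool" where
  "wf_trigraph G \<longleftrightarrow>
     finite (verts G) \<and>
     black G \<subseteq> {e. e \<subseteq> verts G \<and> card e = 2} \<and>
     red G \<subseteq> {e. e \<subseteq> verts G \<and> card e = 2} \<and>
     black G \<inter> red G = {}"

(* The trigraph G/u,v with the vertex replacing u and v named w. *)
definition contract :: "'a trigraph \<Rightarrow> 'a \<Rightarrow> 'a \<Rightarrow> 'a \<Rightarrow> 'a trigraph" where
  "contract G u v w =
     \<lparr> verts = insert w (verts G - {u, v}),
       black = {e \<in> black G. u \<notin> e \<and> v \<notin> e} \<union>
               {{w, x} | x. x \<in> verts G - {u, v} \<and> {u, x} \<in> black G \<and> {v, x} \<in> black G},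
       red = {e \<in> red G. u \<notin> e \<and> v \<notin> e} \<union>
             {{w, x} | x. x \<in> verts G - {u, v} \<and>
                \<not> ({u, x} \<in> black G \<and> {v, x} \<in> black G) \<and>
                \<not> ({u, x} \<notin> black G \<union> red G \<and> {v, x} \<notin> black G \<union> red G)} \<rparr>"

(* The name w only has to differ from those of the remaining vertices, so u and v themselves may
   be reused.  Up to isomorphism this changes nothing, and it keeps contractions available
   when the type 'a has no vertices left outside G. *)
definition is_contraction :: "'a trigraph \<Rightarrow> 'a trigraph \<Rightarrow> bool" where
  "is_contraction G H \<longleftrightarrow>
     (\<exists>u v w. u \<in> verts G \<and> v \<in> verts G \<and> u \<noteq> v \<and> w \<notin> verts G - {u, v} \<and>
        H = contract G u v w)"

definition red_degree :: "'a trigraph \<Rightarrow> 'a \<Rightarrow> nat" where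
  "red_degree G x = card {y. {x, y} \<in> red G}"

definition d_trigraph :: "nat \<Rightarrow> 'a trigraph \<Rightarrow> bool" where
  "d_trigraph d G \<longleftrightarrow> wf_trigraph G \<and> (\<forall>x \<in> verts G. red_degree G x \<le> d)"

(* S i is the i-vertex trigraph of the sequence.  The trigraph without vertices, for which there
   is no such sequence, satisfies this vacuously for every d and so gets twin-width 0. *)
definition contraction_seq :: "nat \<Rightarrow> 'a trigraph \<Rightarrow> (nat \<Rightarrow> 'a trigraph) \<Rightarrow> bool" where
  "contraction_seq d G S \<longleftrightarrow>
     S (card (verts G)) = G \<and>
     (\<forall>i \<in> {1..card (verts G)}. d_trigraph d (S i)) \<and>
     (\<forall>i \<in> {2..card (verts G)}. is_contraction (S i) (S (i - 1))) \<and>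
     card (verts (S 1)) = 1"

definition tww :: "'a trigraph \<Rightarrow> nat" where
  "tww G = (LEAST d. \<exists>S. contraction_seq d G S)"

definition add_vertex :: "'a trigraph \<Rightarrow> 'a \<Rightarrow> 'a set \<Rightarrow> 'a trigraph" where
  "add_vertex G v X =
     \<lparr> verts = insert v (verts G), black = black G \<union> {{v, x} | x. x \<in> X}, red = red G \<rparr>"

lemma verts_contract: "verts (contract G u v w) = insert w (verts G - {u, v})"
  by (simp add: contract_def)

lemma wf_contract:
  assumes G: "wf_trigraph G" and w: "w \<notin> verts G - {u, v}"
  shows "wf_trigraph (contract G u v w)"
proof -
  have 1: "e \<subseteq> insert w (verts G - {u, v}) \<and> card e = 2"
    if "e \<in> black (contract G u v w) \<or> e \<in> red (contract G u v w)" for e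
    using that G w by (auto simp: wf_trigraph_def contract_def card_insert_if)
  have old: "w \<notin> e" if "e \<in> black G \<union> red G" "u \<notin> e" "v \<notin> e" for e
    using that G w by (auto simp: wf_trigraph_def)
  have "e \<notin> red (contract G u v w)" if "e \<in> black (contract G u v w)" for e
  proof (cases "w \<in> e")
    case True
    with that old obtain x where x: "e = {w, x}" "{u, x} \<in> black G" "{v, x} \<in> black G" 
      "x \<in> verts G - {u, v}"
      by (auto simp: contract_def)
    show ?thesis
    proof
      assume "e \<in> red (contract G u v w)"
      with True old obtain y where "e = {w, y}" "\<not> ({u, y} \<in> black G \<and> {v, y} \<in> black G)"
        by (auto simp: contract_def)
      with x show False by (auto simp: doubleton_eq_iff)
    qed
  next
    case False
    with that G show ?thesis by (auto simp: contract_def wf_trigraph_def)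
  qed
  moreover have "finite (verts (contract G u v w))"
    using G by (simp add: wf_trigraph_def contract_def)
  ultimately show ?thesis
    using 1 unfolding wf_trigraph_def verts_contract by blast
qed

lemma wf_add_vertex:
  assumes "wf_trigraph G" "v \<notin> verts G" "X \<subseteq> verts G"
  shows "wf_trigraph (add_vertex G v X)"
  using assms by (auto simp: wf_trigraph_def add_vertex_def card_insert_if)

lemma red_degree_le_card:
  assumes "wf_trigraph G"
  shows "red_degree G x \<le> card (verts G)"
  unfolding red_degree_def
  using assms by (intro card_mono) (auto simp: wf_trigraph_def)

lemma contraction_seq_exists:
  assumes "wf_trigraph G" "card (verts G) \<le> d"
  shows "\<exists>S. contraction_seq d G S"
  using assms
proof (induction "card (verts G)" arbitrary: G)
  case 0
  let ?S = "\<lambda>i. if i = 0 then G else \<lparr>verts = {undefined}, black = {}, red = {}\<rparr>"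
  have "contraction_seq d G ?S"
    using 0 by (auto simp: contraction_seq_def)
  then show ?case by blast
next
  case (Suc n)
  have dG: "d_trigraph d G"
    using Suc.prems red_degree_le_card[of G] by (auto simp: d_trigraph_def intro: order_trans)
  show ?case
  proof (cases "n = 0")
    case True
    then have "contraction_seq d G (\<lambda>_. G)"
      using Suc dG by (simp add: contraction_seq_def)
    then show ?thesis by blast
  next
    case False
    have fin: "finite (verts G)" using Suc.prems by (simp add: wf_trigraph_def)
    obtain u where u: "u \<in> verts G" using Suc.hyps by (metis card.empty ex_in_conv nat.distinct(1))
    have "card (verts G - {u}) = n" using Suc.hyps u fin by simp
    with False obtain v where v: "v \<in> verts G - {u}" by (metis card.empty ex_in_conv)
    let ?H = "contract G u v u"
    have "verts ?H = verts G - {v}" using u v by (auto simp: contract_def)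
    then have cH: "card (verts ?H) = n" using Suc.hyps v fin by simp
    obtain S where S: "contraction_seq d ?H S"
      using Suc.hyps(1)[of ?H] cH wf_contract[of G u u v] Suc by auto
    have c: "is_contraction G ?H"
      unfolding is_contraction_def using u v by blast
    have "contraction_seq d G (S(Suc n := G))"
      unfolding contraction_seq_def Suc.hyps(2)[symmetric]
      using S cH c dG False
      by (auto simp: contraction_seq_def le_Suc_eq)
    then show ?thesis by blast
  qed
qed

end

theory Submission
  imports Defs
begin

text \<open>
  Follow an optimal contraction sequence of \<open>G\<close>, keeping in \<open>G'\<close> the part of each contracted
  vertex inside \<open>X\<close> apart from the part outside \<open>X\<close>. Then \<open>v\<close> never gets a red edge. A contraction
  in \<open>G\<close> is simulated by at most two contractions in \<open>G'\<close>, one on each side of \<open>X\<close>. Between these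
  two, one vertex of the contracted \<open>G\<close> corresponds to at most three vertices of \<open>G'\<close> and every
  other one to at most two. A red edge of \<open>G'\<close> either lies over a red edge of \<open>G\<close> or joins two
  vertices over the same vertex, so red degree \<open>d\<close> becomes at most \<open>2 d + 2\<close>.
\<close>

section \<open>Adjacency after a contraction, and prepending a contraction to a sequence\<close>

lemma contract_old_iff:
  assumes "wf_trigraph G" "w \<notin> verts G - {u, v}" "x \<in> verts G - {u, v}" "y \<in> verts G - {u, v}"
  shows "{x, y} \<in> black (contract G u v w) \<longleftrightarrow> {x, y} \<in> black G"
    and "{x, y} \<in> red (contract G u v w) \<longleftrightarrow> {x, y} \<in> red G"
  using assms by (auto simp: contract_def doubleton_eq_iff)

lemma contract_new_iff:
  assumes "wf_trigraph G" "w \<notin> verts G - {u, v}" "x \<in> verts G - {u, v}"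
  shows "{w, x} \<in> black (contract G u v w) \<longleftrightarrow> {u, x} \<in> black G \<and> {v, x} \<in> black G"
    and "{w, x} \<in> red (contract G u v w) \<longleftrightarrow>
      \<not> ({u, x} \<in> black G \<and> {v, x} \<in> black G) \<and>
      \<not> ({u, x} \<notin> black G \<union> red G \<and> {v, x} \<notin> black G \<union> red G)"
proof -
  \<comment> \<open>A fresh \<open>w\<close> lies on no edge of \<open>G\<close>; if
    \<open>w\<close> is \<open>u\<close> or \<open>v\<close>, the filters in \<open>contract\<close>
    discard every old edge through it. Either way only the newly formed pairs count.\<close>
  have "{w, x} \<notin> black G \<union> red G" if "w \<notin> {u, v}"
    using that assms by (auto simp: wf_trigraph_def)
  with assms show
    "{w, x} \<in> black (contract G u v w) \<longleftrightarrow> {u, x} \<in> black G \<and> {v, x} \<in> black G"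
    "{w, x} \<in> red (contract G u v w) \<longleftrightarrow>
      \<not> ({u, x} \<in> black G \<and> {v, x} \<in> black G) \<and>
      \<not> ({u, x} \<notin> black G \<union> red G \<and> {v, x} \<notin> black G \<union> red G)"
    by (auto simp: contract_def doubleton_eq_iff)
qed

lemma contraction_seq_Cons:
  assumes "d_trigraph d G" "is_contraction G H" "contraction_seq d H S"
  shows "\<exists>S. contraction_seq d G S"
proof -
  obtain u v w where uvw: "u \<in> verts G" "v \<in> verts G" "u \<noteq> v" "w \<notin> verts G - {u, v}"
    and H: "H = contract G u v w"
    using assms(2) by (auto simp: is_contraction_def)
  have fin: "finite (verts G)" using assms(1) by (simp add: d_trigraph_def wf_trigraph_def)
  have "card {u, v} \<le> card (verts G)"
    using uvw fin by (intro card_mono) auto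
  then have two: "2 \<le> card (verts G)" using uvw by simp
  have "card (verts H) = Suc (card (verts G - {u, v}))"
    unfolding H verts_contract using uvw fin by simp
  also have "card (verts G - {u, v}) = card (verts G) - 2"
    using uvw fin by (subst card_Diff_subset) auto
  finally have c: "card (verts G) = Suc (card (verts H))" using two by simp
  \<comment> \<open>Indices count vertices, so \<open>G\<close> goes directly above the sequence of
    \<open>H\<close>, at an index which that sequence leaves unconstrained.\<close>
  have "contraction_seq d G (S(Suc (card (verts H)) := G))"
    unfolding contraction_seq_def c
    using assms two c by (auto simp: contraction_seq_def le_Suc_eq)
  then show ?thesis by blast
qed

section \<open>Trigraphs lying over \<open>G\<close>, their fibers and their red degrees\<close>

text \<open>\<open>H\<close> consists of the vertex \<open>v\<close>, without red edges, and a trigraph that \<open>p\<close> maps to \<open>G\<close>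
  in such a way that a black edge or a non-edge of \<open>G\<close> has only pairs of the same kind above it.\<close>

definition refines :: "'a trigraph \<Rightarrow> 'a \<Rightarrow> ('a \<Rightarrow> 'b) \<Rightarrow> 'b trigraph \<Rightarrow> bool" where
  "refines H v p G \<longleftrightarrow>
     wf_trigraph H \<and> v \<in> verts H \<and> p ` (verts H - {v}) \<subseteq> verts G \<and>
     (\<forall>x. {v, x} \<notin> red H) \<and>
     (\<forall>x \<in> verts H - {v}. \<forall>y \<in> verts H - {v}. p x \<noteq> p y \<longrightarrow>
        ({p x, p y} \<in> black G \<longrightarrow> {x, y} \<in> black H) \<and>
        ({x, y} \<in> black H \<union> red H \<longrightarrow> {p x, p y} \<in> black G \<union> red G))"

text \<open>The flag \<open>b\<close> encodes the side of \<open>X\<close>: adjacency to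
  \<open>v\<close> is at first membership in \<open>X\<close>, and merging only inside a fiber
  preserves it.\<close>

definition fiber :: "'a trigraph \<Rightarrow> 'a \<Rightarrow> ('a \<Rightarrow> 'b) \<Rightarrow> 'b \<Rightarrow> bool \<Rightarrow> 'a set" where
  "fiber H v p z b = {x \<in> verts H - {v}. p x = z \<and> ({v, x} \<in> black H \<longleftrightarrow> b)}"

lemma finite_fiber: "wf_trigraph H \<Longrightarrow> finite (fiber H v p z b)"
  by (simp add: fiber_def wf_trigraph_def)

lemma card_fiber_Un:
  assumes "wf_trigraph H"
  shows "card (fiber H v p z True \<union> fiber H v p z False)
    = card (fiber H v p z True) + card (fiber H v p z False)"
  using assms by (intro card_Un_disjoint finite_fiber) (auto simp: fiber_def)

text \<open>Red neighbours of \<open>x\<close> lie over \<open>p x\<close> or over a red neighbour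
  of \<open>p x\<close>. This gives at most 1 and \<open>2 * d\<close> of them, plus one if the
  exceptional vertex \<open>w\<close> is among these base vertices.\<close>

lemma refines_d_trigraph:
  assumes ref: "refines H v p G" and G: "d_trigraph d G"
    and w: "card (fiber H v p w True) + card (fiber H v p w False) \<le> 3"
    and z: "\<And>z. z \<noteq> w \<Longrightarrow> card (fiber H v p z True) + card (fiber H v p z False) \<le> 2"
  shows "d_trigraph (2 * (d + 1)) H"
  unfolding d_trigraph_def
proof (intro conjI ballI)
  let ?F = "\<lambda>z. fiber H v p z True \<union> fiber H v p z False"
  show wf: "wf_trigraph H" using ref by (simp add: refines_def)
  fix x assume x: "x \<in> verts H"
  show "red_degree H x \<le> 2 * (d + 1)"
  proof (cases "x = v")
    case True
    with ref show ?thesis by (simp add: refines_def red_degree_def)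
  next
    case False
    let ?N = "{z. {p x, z} \<in> red G}"
    have wfG: "wf_trigraph G" using G by (simp add: d_trigraph_def)
    have finN: "finite ?N"
      by (rule finite_subset[of _ "verts G"]) (use wfG in \<open>auto simp: wf_trigraph_def\<close>)
    have "p x \<in> verts G" using ref x False by (auto simp: refines_def)
    then have cN: "card ?N \<le> d" using G by (simp add: d_trigraph_def red_degree_def)
    have pxN: "p x \<notin> ?N" using wfG by (auto simp: wf_trigraph_def)
    have finF: "finite (?F z)" for z using wf by (simp add: finite_fiber)
    have Fw: "card (?F w) \<le> 3" using w card_fiber_Un[OF wf] by metis
    have Fz: "card (?F z) \<le> 2" if "z \<noteq> w" for z using z[OF that] card_fiber_Un[OF wf] by metis
    have "{y. {x, y} \<in> red H} \<subseteq> (?F (p x) - {x}) \<union> (\<Union>z\<in>?N. ?F z)"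
    proof
      fix y assume "y \<in> {y. {x, y} \<in> red H}"
      then have r: "{x, y} \<in> red H" by simp
      have yx: "y \<in> verts H" "y \<noteq> x" using r wf by (auto simp: wf_trigraph_def)
      have yv: "y \<noteq> v" using r ref by (auto simp: refines_def insert_commute)
      have "{p x, p y} \<in> red G" if ne: "p x \<noteq> p y"
      proof -
        \<comment> \<open>A black pair in \<open>G\<close> would force \<open>{x, y}\<close> to be
          black, so the edge below can only be red.\<close>
        have "{x, y} \<notin> black H" using r wf by (auto simp: wf_trigraph_def)
        with ref x False yx yv ne r show ?thesis unfolding refines_def by blast
      qed
      with yx yv show "y \<in> (?F (p x) - {x}) \<union> (\<Union>z\<in>?N. ?F z)"
        by (cases "p x = p y") (auto simp: fiber_def)
    qed
    then have "red_degree H x \<le> card ((?F (p x) - {x}) \<union> (\<Union>z\<in>?N. ?F z))"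
      unfolding red_degree_def using finF finN by (intro card_mono) auto
    also have "\<dots> \<le> card (?F (p x) - {x}) + card (\<Union>z\<in>?N. ?F z)"
      by (rule card_Un_le)
    also have "card (\<Union>z\<in>?N. ?F z) \<le> (\<Sum>z\<in>?N. card (?F z))"
      by (rule card_UN_le[OF finN])
    also have "(\<Sum>z\<in>?N. card (?F z)) \<le> (\<Sum>z\<in>?N. 2 + (if z = w then 1 else 0))"
    proof (rule sum_mono)
      show "card (?F z) \<le> 2 + (if z = w then 1 else 0)" for z
        using Fw Fz[of z] by (cases "z = w") simp_all
    qed
    also have "\<dots> = 2 * card ?N + (if w \<in> ?N then 1 else 0)"
      unfolding sum.distrib using finN by simp
    also have "card (?F (p x) - {x}) = card (?F (p x)) - 1"
      using x False by (intro card_Diff_singleton) (auto simp: fiber_def)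
    finally have deg: "red_degree H x \<le>
        (card (?F (p x)) - 1) + (2 * card ?N + (if w \<in> ?N then 1 else 0))" by simp
    \<comment> \<open>No vertex is its own red neighbour, so the surplus at \<open>w\<close> is
      counted either over \<open>p x\<close> or over a neighbour, never twice.\<close>
    have extra: "(card (?F (p x)) - 1) + (if w \<in> ?N then 1 else 0) \<le> 2"
      using Fw Fz[of "p x"] pxN by (cases "p x = w") auto
    have "r \<le> 2 * (d + 1)" if "r \<le> f + (2 * n + e)" "f + e \<le> 2" "n \<le> d" for r f n e :: nat
      using that by simp
    from this[OF deg extra cN] show ?thesis .
  qed
qed

section \<open>Contracting in the base and inside a fiber\<close>

text \<open>Here \<open>H\<close> stays fixed. A pair at \<open>w\<close> is black, or a non-edge,
  only if the pairs at \<open>u\<close> and at \<open>t\<close> both were, so the condition on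
  vertices of \<open>H\<close> over either of them carries over.\<close>

lemma refines_contract_base:
  assumes ref: "refines H v p G" and G: "wf_trigraph G"
    and w: "w \<notin> verts G - {u, t}"
  shows "refines H v (\<lambda>x. if p x \<in> {u, t} then w else p x) (contract G u t w)"
    (is "refines H v ?q ?G")
proof -
  have "({?q x, ?q y} \<in> black ?G \<longrightarrow> {x, y} \<in> black H) \<and>
      ({x, y} \<in> black H \<union> red H \<longrightarrow> {?q x, ?q y} \<in> black ?G \<union> red ?G)"
    if xy: "x \<in> verts H - {v}" "y \<in> verts H - {v}" and ne: "?q x \<noteq> ?q y" for x y
  proof -
    have old: "({p x, p y} \<in> black G \<longrightarrow> {x, y} \<in> black H) \<and>
      ({x, y} \<in> black H \<union> red H \<longrightarrow> {p x, p y} \<in> black G \<union> red G)"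
      using ref xy ne unfolding refines_def by metis
    have V: "p x \<in> verts G" "p y \<in> verts G" using ref xy by (auto simp: refines_def)
    consider (neither) "p x \<notin> {u, t}" "p y \<notin> {u, t}"
      | (left) "p x \<in> {u, t}" "p y \<notin> {u, t}"
      | (right) "p x \<notin> {u, t}" "p y \<in> {u, t}"
      using ne by (cases "p x \<in> {u, t}"; cases "p y \<in> {u, t}") simp_all
    then show ?thesis
    proof cases
      case neither
      with V contract_old_iff[OF G w, of "p x" "p y"] old show ?thesis by auto
    next
      case left
      with V contract_new_iff[OF G w, of "p y"] old show ?thesis by auto
    next
      case right
      with V contract_new_iff[OF G w, of "p x"] old show ?thesis
        by (auto simp: insert_commute)
    qed
  qed
  moreover have "?q ` (verts H - {v}) \<subseteq> verts ?G"
    using ref by (auto simp: verts_contract refines_def)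
  ultimately show ?thesis
    using ref unfolding refines_def by blast
qed

text \<open>Seen from \<open>v\<close>, which has no red edges, \<open>a\<close> and
  \<open>c\<close> look alike, so the merged vertex gets no red edge to \<open>v\<close>. Having the
  same image, both comply wherever \<open>G\<close> prescribes a black edge or a non-edge, and so
  does the merged vertex. Reusing the name \<open>a\<close> keeps \<open>p\<close> valid.\<close>

lemma refines_contract:
  assumes ref: "refines H v p G" and ac: "a \<in> fiber H v p z b" "c \<in> fiber H v p z b" "a \<noteq> c"
  shows "refines (contract H a c a) v p G"
    and "fiber (contract H a c a) v p z' b' = fiber H v p z' b' - {c}"
proof -
  let ?H = "contract H a c a"
  have wf: "wf_trigraph H" using ref by (simp add: refines_def)
  have a: "a \<in> verts H" "a \<noteq> v" "p a = z" "{v, a} \<in> black H \<longleftrightarrow> b"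
    and c: "c \<in> verts H" "c \<noteq> v" "p c = z" "{v, c} \<in> black H \<longleftrightarrow> b"
    using ac by (auto simp: fiber_def)
  have V: "verts ?H = verts H - {c}" using a ac(3) by (auto simp: verts_contract)
  have wf': "wf_trigraph ?H" using wf by (simp add: wf_contract)
  have na: "a \<notin> verts H - {a, c}" by simp
  have v: "v \<in> verts H - {a, c}" using ref a c by (auto simp: refines_def)
  note va = contract_new_iff[OF wf na v]
  have red_v: "{v, x} \<notin> red H" for x using ref by (simp add: refines_def)
  have side: "{v, x} \<in> black ?H \<longleftrightarrow> {v, x} \<in> black H" if "x \<in> verts H - {c}" for x
    using that va contract_old_iff[OF wf na v, of x] a c
    by (cases "x = a") (auto simp: insert_commute)
  have "{v, x} \<notin> red ?H" for x
  proof
    assume r: "{v, x} \<in> red ?H"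
    then have "x \<in> verts H - {c}" using wf' V by (auto simp: wf_trigraph_def)
    then show False
      using r va contract_old_iff[OF wf na v, of x] a c red_v
      by (cases "x = a") (auto simp: insert_commute)
  qed
  moreover have "({p x, p y} \<in> black G \<longrightarrow> {x, y} \<in> black ?H) \<and>
      ({x, y} \<in> black ?H \<union> red ?H \<longrightarrow> {p x, p y} \<in> black G \<union> red G)"
    if xy: "x \<in> verts H - {c} - {v}" "y \<in> verts H - {c} - {v}" and ne: "p x \<noteq> p y" for x y
  proof -
    have old: "({p x', p y'} \<in> black G \<longrightarrow> {x', y'} \<in> black H) \<and>
      ({x', y'} \<in> black H \<union> red H \<longrightarrow> {p x', p y'} \<in> black G \<union> red G)"
      if "x' \<in> verts H - {v}" "y' \<in> verts H - {v}" "p x' \<noteq> p y'" for x' y'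
      using ref that unfolding refines_def by metis
    consider (neither) "x \<noteq> a" "y \<noteq> a" | (left) "x = a" "y \<noteq> a" | (right) "x \<noteq> a" "y = a"
      using ne by auto
    then show ?thesis
    proof cases
      case neither
      with xy contract_old_iff[OF wf na, of x y] old[of x y] ne show ?thesis by auto
    next
      case left
      with xy contract_new_iff[OF wf na, of y] old[of a y] old[of c y] ne a c
      show ?thesis by auto
    next
      case right
      with xy contract_new_iff[OF wf na, of x] old[of a x] old[of c x] ne a c
      show ?thesis by (auto simp: insert_commute)
    qed
  qed
  ultimately show "refines ?H v p G"
    using ref wf' V v unfolding refines_def by auto
  show "fiber ?H v p z' b' = fiber H v p z' b' - {c}"
    using side unfolding fiber_def V by blast
qed

section \<open>Simulating a contraction sequence of \<open>G\<close>\<close>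

text \<open>The premise \<open>step\<close> is the rest of the simulation. This treats alike a fiber
  of two vertices, which costs one contraction, and a smaller one, which costs none.\<close>

lemma contraction_seq_collapse:
  assumes ref: "refines H v p G" and H: "d_trigraph D H" and c2: "card (fiber H v p w b) \<le> 2"
    and step: "\<And>H'. \<lbrakk>refines H' v p G; card (fiber H' v p w b) \<le> 1;
      \<And>z b'. (z, b') \<noteq> (w, b) \<Longrightarrow> fiber H' v p z b' = fiber H v p z b'\<rbrakk>
      \<Longrightarrow> \<exists>S. contraction_seq D H' S"
  shows "\<exists>S. contraction_seq D H S"
proof (cases "card (fiber H v p w b) \<le> 1")
  case True
  with step ref show ?thesis by blast
next
  case False
  with c2 have "card (fiber H v p w b) = 2" by simp
  then obtain a c where ac: "fiber H v p w b = {a, c}" "a \<noteq> c"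
    by (auto simp: card_2_iff)
  then have m: "a \<in> fiber H v p w b" "c \<in> fiber H v p w b" by auto
  let ?H = "contract H a c a"
  note r = refines_contract[OF ref m ac(2)]
  have "fiber ?H v p z b' = fiber H v p z b'" if "(z, b') \<noteq> (w, b)" for z b'
    using m(2) that unfolding r(2) by (auto simp: fiber_def)
  moreover have "card (fiber ?H v p w b) \<le> 1" unfolding r(2) ac(1) using ac(2)
    by (simp add: insert_Diff_if)
  ultimately obtain S where "contraction_seq D ?H S" using step r(1) by blast
  moreover have "is_contraction H ?H"
    unfolding is_contraction_def using m ac(2) by (auto simp: fiber_def)
  ultimately show ?thesis using contraction_seq_Cons H by blast
qed

text \<open>Serves the end of the simulation: \<open>v\<close> and at most two vertices over the
  last vertex of \<open>G\<close>. For \<open>D = 2\<close> the bound by the number of vertices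
  applies only after one contraction.\<close>

lemma contraction_seq_three:
  assumes "d_trigraph D H" "card (verts H) \<le> 3" "2 \<le> D"
  shows "\<exists>S. contraction_seq D H S"
proof (cases "card (verts H) \<le> 2")
  case True
  with assms show ?thesis by (intro contraction_seq_exists) (auto simp: d_trigraph_def)
next
  case False
  with assms obtain a b c where abc: "verts H = {a, b, c}" "a \<noteq> b" "b \<noteq> c" "a \<noteq> c"
    by (metis card_3_iff le_antisym not_less_eq_eq numeral_2_eq_2 numeral_3_eq_3)
  have "wf_trigraph (contract H a b a)"
    using assms by (intro wf_contract) (auto simp: d_trigraph_def)
  moreover have "card (verts (contract H a b a)) \<le> D"
    using abc assms(3) by (simp add: verts_contract insert_Diff_if)
  ultimately obtain S where "contraction_seq D (contract H a b a) S"
    using contraction_seq_exists by blast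
  moreover have "is_contraction H (contract H a b a)"
    unfolding is_contraction_def using abc by blast
  ultimately show ?thesis using contraction_seq_Cons assms(1) by blast
qed

lemma refines_contraction_seq:
  assumes "contraction_seq d G S" "verts G \<noteq> {}" "wf_trigraph G" "refines H v p G"
    and "\<And>z b. card (fiber H v p z b) \<le> 1"
  shows "\<exists>T. contraction_seq (2 * (d + 1)) H T"
  using assms
\<comment> \<open>\<open>S\<close> stays fixed: being indexed by the number of vertices, it is also
  a sequence for the contracted trigraph.\<close>
proof (induction "card (verts G)" arbitrary: G H p rule: less_induct)
  case less
  let ?D = "2 * (d + 1)"
  let ?n = "card (verts G)"
  have n: "?n \<ge> 1"
    using less.prems(2,3) by (simp add: wf_trigraph_def Suc_le_eq card_gt_0_iff)
  have Sn: "S ?n = G" using less.prems(1) by (simp add: contraction_seq_def)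
  have "d_trigraph d (S ?n)"
    using less.prems(1) n unfolding contraction_seq_def by (meson atLeastAtMost_iff order_refl)
  then have dG: "d_trigraph d G" by (simp add: Sn)
  have two: "card (fiber H v p z True) + card (fiber H v p z False) \<le> 2" for z
    using add_mono[OF less.prems(5)[of z True] less.prems(5)[of z False]] by simp
  have three: "card (fiber H v p z True) + card (fiber H v p z False) \<le> 3" for z
    using two[of z] by simp
  have wfH: "wf_trigraph H" using less.prems(4) by (simp add: refines_def)
  have dH: "d_trigraph ?D H"
    by (rule refines_d_trigraph[OF less.prems(4) dG three two])
  show ?case
  proof (cases "?n = 1")
    case True
    then obtain z where z: "verts G = {z}" by (auto simp: card_1_singleton_iff)
    have "p ` (verts H - {v}) \<subseteq> {z}" using less.prems(4) z by (simp add: refines_def)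
    then have sub: "verts H \<subseteq> insert v (fiber H v p z True \<union> fiber H v p z False)"
      by (auto simp: fiber_def)
    have "card (verts H) \<le> card (insert v (fiber H v p z True \<union> fiber H v p z False))"
      by (rule card_mono[OF _ sub]) (simp add: finite_fiber[OF wfH])
    also have "\<dots> \<le> Suc (card (fiber H v p z True \<union> fiber H v p z False))"
      by (rule card_insert_le_m1) simp_all
    also have "\<dots> \<le> 3" using two[of z] by (simp add: card_fiber_Un[OF wfH])
    finally show ?thesis using contraction_seq_three[OF dH] by simp
  next
    case False
    let ?G = "S (?n - 1)"
    have n2: "?n \<in> {2..?n}" using False n by simp
    then have "is_contraction (S ?n) ?G"
      using less.prems(1) unfolding contraction_seq_def by blast
    then have "is_contraction G ?G" by (simp add: Sn)
    then obtain u t w where ut: "u \<in> verts G" "t \<in> verts G" "u \<noteq> t" "w \<notin> verts G - {u, t}"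
      and G': "?G = contract G u t w"
      unfolding is_contraction_def by blast
    have fin: "finite (verts G)" using less.prems(3) by (simp add: wf_trigraph_def)
    have "card (verts ?G) = Suc (card (verts G - {u, t}))"
      unfolding G' verts_contract using ut fin by simp
    also have "card (verts G - {u, t}) = ?n - 2"
      using ut fin by (subst card_Diff_subset) auto
    finally have cG': "card (verts ?G) = ?n - 1" using n2 by simp
    have seq': "contraction_seq d ?G S"
      using less.prems(1) unfolding contraction_seq_def cG' by auto
    have "?n - 1 \<in> {1..?n}" using n2 by simp
    then have dG': "d_trigraph d ?G"
      using less.prems(1) unfolding contraction_seq_def by blast
    define q where "q = (\<lambda>x. if p x \<in> {u, t} then w else p x)"
    have refq: "refines H v q ?G"
      unfolding q_def G' by (rule refines_contract_base[OF less.prems(4,3) ut(4)])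
    have qz: "card (fiber H v q z b) \<le> 1" if "z \<noteq> w" for z b
    proof -
      have "fiber H v q z b \<subseteq> fiber H v p z b"
        using that by (auto simp: fiber_def q_def split: if_splits)
      then show ?thesis
        using less.prems(5)[of z b] card_mono finite_fiber[OF wfH] order_trans by metis
    qed
    have qw: "card (fiber H v q w b) \<le> 2" for b
    proof -
      have "p x \<in> verts G" if "x \<in> verts H - {v}" for x
        using that less.prems(4) by (auto simp: refines_def)
      \<comment> \<open>By the choice of \<open>w\<close>, no vertex outside the fibers of
        \<open>u\<close> and \<open>t\<close> can already be mapped to \<open>w\<close>.\<close>
      then have "fiber H v q w b \<subseteq> fiber H v p u b \<union> fiber H v p t b"
        using ut(4) by (auto simp: fiber_def q_def split: if_splits)
      then have "card (fiber H v q w b) \<le> card (fiber H v p u b \<union> fiber H v p t b)"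
        by (intro card_mono) (simp_all add: finite_fiber[OF wfH])
      also have "\<dots> \<le> card (fiber H v p u b) + card (fiber H v p t b)" by (rule card_Un_le)
      also have "\<dots> \<le> 2"
        using add_mono[OF less.prems(5)[of u b] less.prems(5)[of t b]] by simp
      finally show ?thesis .
    qed
    show ?thesis
    \<comment> \<open>The red bound \<open>dH\<close> for \<open>H\<close> was obtained through
      \<open>p\<close>; through \<open>q\<close> there may be four vertices over \<open>w\<close>,
      too many for \<open>refines_d_trigraph\<close>.\<close>
    proof (rule contraction_seq_collapse[OF refq dH qw[of True]])
      fix H1 assume H1: "refines H1 v q ?G" "card (fiber H1 v q w True) \<le> 1"
        "\<And>z b'. (z, b') \<noteq> (w, True) \<Longrightarrow> fiber H1 v q z b' = fiber H v q z b'"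
      have w1: "card (fiber H1 v q w False) \<le> 2" using H1(3)[of w False] qw by simp
      have z1: "card (fiber H1 v q z b) \<le> 1" if "z \<noteq> w" for z b
        using H1(3)[of z b] qz that by simp
      \<comment> \<open>One side over \<open>w\<close> is merged and the other may still have two
        vertices: the case of three for which \<open>refines_d_trigraph\<close> makes its
        exception.\<close>
      have "d_trigraph ?D H1"
      proof (rule refines_d_trigraph[OF H1(1) dG'])
        show "card (fiber H1 v q w True) + card (fiber H1 v q w False) \<le> 3"
          using H1(2) w1 by simp
        show "card (fiber H1 v q z True) + card (fiber H1 v q z False) \<le> 2" if "z \<noteq> w" for z
          using z1[OF that, of True] z1[OF that, of False] by simp
      qed
      from H1(1) this w1 show "\<exists>T. contraction_seq ?D H1 T"
      proof (rule contraction_seq_collapse)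
        fix H2 assume H2: "refines H2 v q ?G" "card (fiber H2 v q w False) \<le> 1"
          "\<And>z b'. (z, b') \<noteq> (w, False) \<Longrightarrow> fiber H2 v q z b' = fiber H1 v q z b'"
        have "card (fiber H2 v q z b) \<le> 1" for z b
        proof (cases "z = w")
          case True
          with H2(2) H2(3)[of w True] H1(2) show ?thesis by (cases b) auto
        next
          case False
          with H2(3)[of z b] z1 show ?thesis by simp
        qed
        moreover have "card (verts ?G) < ?n" using cG' n by simp
        moreover have "verts ?G \<noteq> {}" unfolding G' verts_contract by simp
        moreover have "wf_trigraph ?G" using dG' by (simp add: d_trigraph_def)
        ultimately show "\<exists>T. contraction_seq ?D H2 T"
          using less.hyps[OF _ seq'] H2(1) by blast
      qed
    qed
  qed
qed

section \<open>The trigraph with the added vertex, and the bound\<close>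

lemma refines_add_vertex:
  assumes "wf_trigraph G" "v \<notin> verts G" "X \<subseteq> verts G"
  shows "refines (add_vertex G v X) v id G"
  unfolding refines_def
proof (intro conjI)
  show "wf_trigraph (add_vertex G v X)" using assms by (rule wf_add_vertex)
qed (use assms in \<open>auto simp: add_vertex_def wf_trigraph_def doubleton_eq_iff\<close>)

theorem theorem4p1:
  fixes G :: "'a trigraph" and v :: 'a and X :: "'a set"
  assumes "wf_trigraph G" and "v \<notin> verts G" and "X \<subseteq> verts G"
  shows "tww (add_vertex G v X) \<le> 2 * (tww G + 1)"
proof -
  let ?H = "add_vertex G v X"
  have "\<exists>S. contraction_seq (2 * (tww G + 1)) ?H S"
  proof (cases "verts G = {}")
    case True
    \<comment> \<open>Only \<open>v\<close> is present, so the number of vertices, 1, is already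
      below the bound.\<close>
    then show ?thesis
      using wf_add_vertex[OF assms] by (intro contraction_seq_exists) (simp_all add: add_vertex_def)
  next
    case False
    have "\<exists>d S. contraction_seq d G S" using contraction_seq_exists[OF assms(1)] by blast
    then obtain S where S: "contraction_seq (tww G) G S"
      unfolding tww_def using LeastI_ex[of "\<lambda>d. \<exists>S. contraction_seq d G S"] by blast
    have "card (fiber ?H v id z b) \<le> 1" for z b
    proof -
      have "fiber ?H v id z b \<subseteq> {z}" by (auto simp: fiber_def)
      then show ?thesis using card_mono[of "{z}"] by simp
    qed
    then show ?thesis
      using refines_contraction_seq[OF S False assms(1) refines_add_vertex[OF assms]] by blast
  qed
  then show ?thesis unfolding tww_def by (rule Least_le)
qed

end
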